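(* Let $p$ be a prime number, let $R$ be a commutative ring, and let $\Phi: R \to R$ be a ring endomorphism satisfying $\Phi(r) \equiv r^p \bmod pR$ for all $r \in R$. Let $\Lambda \in R[x_1^{\pm 1},\ldots,x_N^{\pm 1}]$ be a Laurent polynomial, let $J = \mathrm{Newt}(\Lambda)^{\circ} \cap \mathbb{Z}^N$ be the set of internal integral points of its Newton polytope, and let $h = \#J$. For $s \ge 0$ let $\alpha_s$ be the $h\times h$ matrix with entries in $R$, with rows and columns indexed by $J$, given by $$(\alpha_s)_{u,v} = \text{the coefficient of } x^{p^s v - u} \text{ in } \Lambda(x)^{p^s-1}, \qquad u,v\in J.$$ Then: (i) For every $s \ge 1$, $$\alpha_s \equiv \alpha_1 \cdot \Phi(\alpha_1) \cdot \ldots \cdot \Phi^{s-1}(\alpha_1) \mod p.$$ (ii) Assume that all matrices $\alpha_s$ are invertible (as $h \times h$ matrices over $R$). Then for every $s \ge 1$, $$\alpha_{s+1}\cdot \Phi(\alpha_s)^{-1} \equiv \alpha_s \cdot \Phi(\alpha_{s-1})^{-1} \mod p^s.$$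
   Context: Write $\Lambda(x)=\sum_u a_u x^u$ (finite sum over $u \in \mathbb{Z}^N$, $a_u\in R$, $x^u = x_1^{u_1}\cdots x_N^{u_N}$). The support is $\mathrm{supp}(\Lambda)=\{u : a_u \neq 0\}$ and the Newton polytope $\mathrm{Newt}(\Lambda)\subset\mathbb{R}^N$ is the convex hull of $\mathrm{supp}(\Lambda)$. $\mathrm{Newt}(\Lambda)^{\circ}$ denotes its topological interior; if $\mathrm{Newt}(\Lambda)$ lies in a hyperplane, one restricts to that hyperplane to define the interior (i.e. it is the relative interior, the interior within the affine hull). $\Phi$ and its iterates $\Phi^i$ are applied to matrices entry-wise. A congruence of matrices modulo $p^s$ means that all entries of the difference lie in $p^sR$. *)

theory Defs
  imports
    "HOL-Analysis.Analysis"
    "HOL-Library.Poly_Mapping"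
    "HOL-Computational_Algebra.Primes"
    "Jordan_Normal_Form.Matrix"
begin

text \<open>
  The monoid algebra of \<open>\<int>\<^sup>N\<close> over the ring of coefficients: since \<open>int ^ 'n\<close> is an
  additive group, the convolution product on finitely supported functions is the
  product of Laurent polynomials, and \<open>lookup \<Lambda> u\<close> is the coefficient of \<open>x\<^sup>u\<close>.
\<close>

type_synonym ('a, 'n) laurent_poly = "(int ^ 'n) \<Rightarrow>\<^sub>0 'a"

definition real_point :: "int ^ 'n \<Rightarrow> real ^ 'n" where
  "real_point u = (\<chi> i. real_of_int (vec_nth u i))"

definition newton_polytope :: "('a::zero, 'n::finite) laurent_poly \<Rightarrow> (real ^ 'n) set" where
  "newton_polytope \<Lambda> = convex hull (real_point ` Poly_Mapping.keys \<Lambda>)"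

definition internal_points :: "('a::zero, 'n::finite) laurent_poly \<Rightarrow> (int ^ 'n) set" where
  "internal_points \<Lambda> = {u. real_point u \<in> rel_interior (newton_polytope \<Lambda>)}"

lemma finite_internal_points: "finite (internal_points \<Lambda>)"
proof -
  have "bounded (newton_polytope \<Lambda>)"
    unfolding newton_polytope_def
    by (rule bounded_convex_hull, rule finite_imp_bounded, rule finite_imageI, rule finite_keys)
  then obtain B where B: "\<And>x. x \<in> newton_polytope \<Lambda> \<Longrightarrow> norm x \<le> B"
    unfolding bounded_iff by blast
  have "vec_nth u i \<in> {- \<lceil>B\<rceil>..\<lceil>B\<rceil>}" if "u \<in> internal_points \<Lambda>" for u i
  proof -
    have "real_point u \<in> newton_polytope \<Lambda>"
      using that rel_interior_subset unfolding internal_points_def by blast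
    then have "\<bar>vec_nth (real_point u) i\<bar> \<le> B"
      using B component_le_norm_cart order_trans by blast
    then have "\<bar>real_of_int (vec_nth u i)\<bar> \<le> B"
      by (simp add: real_point_def)
    then show ?thesis
      by (simp only: atLeastAtMost_iff) linarith
  qed
  then have "vec_nth ` internal_points \<Lambda> \<subseteq> PiE UNIV (\<lambda>_. {- \<lceil>B\<rceil>..\<lceil>B\<rceil>})"
    by (intro subsetI PiE_I) (blast, simp)
  then have "finite (vec_nth ` internal_points \<Lambda>)"
    by (rule finite_subset) (rule finite_PiE, rule finite, rule finite_atLeastAtMost_int)
  then show ?thesis
    by (rule finite_imageD) (auto intro: inj_onI simp only: vec_nth_inject)
qed

text \<open>
  The matrix \<open>\<alpha>\<^sub>s\<close>. Rows and columns are indexed through a list \<open>us\<close> that enumerates the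
  internal integral points without repetition.
\<close>

definition hasse_witt ::
    "nat \<Rightarrow> ('a::comm_ring_1, 'n::finite) laurent_poly \<Rightarrow> (int ^ 'n) list \<Rightarrow> nat \<Rightarrow> 'a mat" where
  "hasse_witt p \<Lambda> us s = Matrix.mat (length us) (length us)
     (\<lambda>(i, j). Poly_Mapping.lookup (\<Lambda> ^ (p ^ s - 1)) (int (p ^ s) *s (us ! j) - us ! i))"

text \<open>Meaningful only for invertible matrices; the inverse is then unique.\<close>

definition inverse_mat :: "'a::comm_ring_1 mat \<Rightarrow> 'a mat" where
  "inverse_mat A = (THE B. inverts_mat A B \<and> inverts_mat B A)"

lemma inverse_mat_unique:
  assumes AB: "inverts_mat A B" "inverts_mat B A" and AC: "inverts_mat A C" "inverts_mat C A"
  shows "B = (C :: 'a::comm_ring_1 mat)"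
proof -
  define n where "n = dim_row A"
  have B: "A * B = 1\<^sub>m n" "B * A = 1\<^sub>m (dim_row B)"
    and C: "A * C = 1\<^sub>m n" "C * A = 1\<^sub>m (dim_row C)"
    using AB AC by (auto simp: inverts_mat_def n_def)
  have dims: "dim_col B = n" "dim_col A = dim_row B" "dim_col C = n" "dim_col A = dim_row C"
    using arg_cong[OF B(1), of dim_col] arg_cong[OF B(2), of dim_col]
      arg_cong[OF C(1), of dim_col] arg_cong[OF C(2), of dim_col] by auto
  have cA: "A \<in> carrier_mat n (dim_row B)" and cB: "B \<in> carrier_mat (dim_row B) n"
    and cC: "C \<in> carrier_mat (dim_row B) n"
    using dims by (auto simp: n_def)
  have "B = B * (A * C)" unfolding C(1) by (rule right_mult_one_mat[OF cB, symmetric])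
  also have "\<dots> = (B * A) * C" by (rule assoc_mult_mat[OF cB cA cC, symmetric])
  also have "\<dots> = C" unfolding B(2) by (rule left_mult_one_mat[OF cC])
  finally show ?thesis .
qed

lemma inverse_mat:
  assumes "invertible_mat (A :: 'a::comm_ring_1 mat)"
  shows "inverts_mat A (inverse_mat A)" "inverts_mat (inverse_mat A) A"
proof -
  obtain B where B: "inverts_mat A B" "inverts_mat B A"
    using assms unfolding invertible_mat_def by auto
  have "inverse_mat A = B"
    unfolding inverse_mat_def
  proof (rule the_equality)
    show "C = B" if "inverts_mat A C \<and> inverts_mat C A" for C
      using that by (intro inverse_mat_unique[OF _ _ B]) simp_all
  qed (simp add: B)
  then show "inverts_mat A (inverse_mat A)" "inverts_mat (inverse_mat A) A" using B by simp_all
qed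

definition mat_cong :: "nat \<Rightarrow> 'a::comm_ring_1 mat \<Rightarrow> 'a mat \<Rightarrow> bool" where
  "mat_cong m A B \<longleftrightarrow> dim_row A = dim_row B \<and> dim_col A = dim_col B \<and>
     (\<forall>i < dim_row A. \<forall>j < dim_col A. of_nat m dvd A $$ (i, j) - B $$ (i, j))"

end

(* Let sigma be the lift of Frobenius to Laurent polynomials that acts by Phi on coefficients and
   by x -> x^p on monomials, so that L i = sigma^i(Lambda) satisfies L (i+1) = (L i)^p mod p. Define
   G_s recursively by
     Lambda^(p^s - 1) = sum over 1 <= j <= s of G_j * sigma^j(Lambda^(p^(s-j) - 1)).
   Comparing the relations for s and s - 1 shows that p^(s-1) divides G_s. Since G_j is supported in
   (p^j - 1) Newt(Lambda), an exponent p^j w - u of G_j with u internal forces w to be internal, so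
   taking coefficients gives
     alpha_s = sum over 1 <= j <= s of gamma_j * Phi^j(alpha_(s-j))
   with gamma_j divisible by p^(j-1) and alpha_0 = 1. Reduction modulo p is (i). For (ii), multiply
   the relation for s + 1 by Phi(alpha_s)^(-1) and compare term by term, by induction on s. *)

theory Submission
  imports Defs
begin

section \<open>Powers modulo prime powers\<close>

lemma of_nat_dvd_of_nat:
  assumes "m dvd n"
  shows "of_nat m dvd (of_nat n :: 'a::comm_semiring_1)"
  using assms by (elim dvdE) simp

text \<open>Factor \<open>a ^ p - b ^ p\<close> as \<open>a - b\<close> times the sum of all
  \<open>b ^ (p - 1 - i) * a ^ i\<close>. Since \<open>a\<close> and \<open>b\<close> agree modulo
  \<open>p\<close>, that sum is congruent to \<open>p * b ^ (p - 1)\<close>, which supplies the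
  additional factor \<open>p\<close>.\<close>

lemma power_prime_cong:
  fixes a b :: "'a::comm_ring_1"
  assumes "0 < k" and "of_nat (p ^ k) dvd a - b"
  shows "of_nat (p ^ Suc k) dvd a ^ p - b ^ p"
proof -
  have pk: "of_nat p dvd a - b"
    by (rule dvd_trans[OF of_nat_dvd_of_nat assms(2)]) (use assms(1) in simp)
  have "of_nat p dvd a ^ i - b ^ i" for i
    using pk dvd_trans power_diff_sumr2[of a i b] by (metis dvd_mult2)
  then have "of_nat p dvd (\<Sum>i<p. b ^ (p - Suc i) * (a ^ i - b ^ i))"
    by (intro dvd_sum dvd_mult)
  moreover have "(\<Sum>i<p. b ^ (p - Suc i) * a ^ i) =
      (\<Sum>i<p. b ^ (p - Suc i) * (a ^ i - b ^ i)) + of_nat p * b ^ (p - 1)"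
  proof -
    have "(\<Sum>i<p. b ^ (p - Suc i) * b ^ i) = (\<Sum>i<p. b ^ (p - 1))"
      by (intro sum.cong) (auto simp flip: power_add)
    then show ?thesis by (simp add: algebra_simps sum_subtractf)
  qed
  ultimately have "of_nat p dvd (\<Sum>i<p. b ^ (p - Suc i) * a ^ i)"
    by simp
  then have "of_nat (p ^ k) * of_nat p dvd (a - b) * (\<Sum>i<p. b ^ (p - Suc i) * a ^ i)"
    using assms(2) by (intro mult_dvd_mono)
  then show ?thesis
    by (simp add: power_diff_sumr2 mult.commute)
qed

text \<open>Each further \<open>p\<close>-th power gains one factor \<open>p\<close> in the
  modulus.\<close>

lemma power_prime_power_cong:
  fixes a b :: "'a::comm_ring_1"
  assumes "of_nat p dvd a - b"
  shows "of_nat (p ^ Suc k) dvd a ^ (p ^ k) - b ^ (p ^ k)"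
proof (induction k)
  case 0
  then show ?case using assms by simp
next
  case (Suc k)
  from power_prime_cong[OF _ Suc] show ?case
    by (simp add: power_mult[symmetric] mult.commute)
qed

text \<open>The inner binomial coefficients are divisible by \<open>p\<close>.\<close>

lemma prime_power_add_cong:
  fixes a b :: "'a::comm_ring_1"
  assumes "prime p"
  shows "of_nat p dvd (a + b) ^ p - (a ^ p + b ^ p)"
proof -
  have p: "p > 1" using assms prime_gt_1_nat by blast
  have "(a + b) ^ p = (\<Sum>k\<le>p. of_nat (p choose k) * a ^ k * b ^ (p - k))"
    by (rule binomial_ring)
  also have "{..p} = insert 0 (insert p {1..<p})" using p by auto
  also have "(\<Sum>k\<in>insert 0 (insert p {1..<p}). of_nat (p choose k) * a ^ k * b ^ (p - k)) =
      b ^ p + (a ^ p + (\<Sum>k\<in>{1..<p}. of_nat (p choose k) * a ^ k * b ^ (p - k)))"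
    using p by simp
  finally have "(a + b) ^ p - (a ^ p + b ^ p) =
      (\<Sum>k\<in>{1..<p}. of_nat (p choose k) * a ^ k * b ^ (p - k))" by simp
  also have "of_nat p dvd \<dots>"
  proof (intro dvd_sum dvd_mult2)
    fix k assume "k \<in> {1..<p}"
    then have "p dvd (p choose k)" using assms by (intro dvd_choose_prime) auto
    then show "(of_nat p :: 'a) dvd of_nat (p choose k)" by (rule of_nat_dvd_of_nat)
  qed
  finally show ?thesis .
qed

lemma prime_power_sum_cong:
  fixes f :: "'b \<Rightarrow> 'a::comm_ring_1"
  assumes "prime p" and "finite A"
  shows "of_nat p dvd (\<Sum>x\<in>A. f x) ^ p - (\<Sum>x\<in>A. f x ^ p)"
  using assms(2)
proof induction
  case empty
  then show ?case using prime_gt_0_nat[OF assms(1)] by (simp add: power_0_left)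
next
  case (insert x F)
  from dvd_add[OF prime_power_add_cong[OF assms(1), of "f x" "sum f F"] insert.IH]
  show ?case using insert.hyps by (simp add: algebra_simps)
qed

section \<open>The factors G_s attached to a sequence of elements of a commutative ring\<close>

fun dwork_factor :: "nat \<Rightarrow> (nat \<Rightarrow> 'a::comm_ring_1) \<Rightarrow> nat \<Rightarrow> 'a" where
  "dwork_factor p L s =
     L 0 ^ (p ^ s - 1) - (\<Sum>j\<in>{1..<s}. dwork_factor p L j * L j ^ (p ^ (s - j) - 1))"

text \<open>As a rewrite rule the unconditional recursion would unfold forever under the
  sum.\<close>

declare dwork_factor.simps [simp del]

text \<open>At \<open>j = s\<close> the exponent \<open>p ^ 0 - 1\<close> is 0, so the recursion is
  this relation solved for its last term.\<close>

lemma dwork_factor_decomp: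
  assumes "1 \<le> s"
  shows "L 0 ^ (p ^ s - 1) = (\<Sum>j\<in>{1..s}. dwork_factor p L j * L j ^ (p ^ (s - j) - 1))"
proof -
  have "{1..s} = insert s {1..<s}" using assms by auto
  then show ?thesis by (simp add: dwork_factor.simps[of p L s])
qed

text \<open>Strong induction on \<open>s\<close>. Subtracting a multiple of the relation for
  \<open>s - 1\<close> leaves terms that collect \<open>p ^ (j - 1)\<close> from the induction
  hypothesis and \<open>p ^ (s - j)\<close> from the difference \<open>q 0 - q j\<close>.\<close>

lemma dwork_factor_dvd:
  fixes L :: "nat \<Rightarrow> 'a::comm_ring_1"
  assumes "prime p" and L: "\<And>i. of_nat p dvd L i ^ p - L (Suc i)"
  shows "of_nat (p ^ (s - 1)) dvd dwork_factor p L s"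
proof (induction s rule: less_induct)
  case (less s)
  show ?case
  proof (cases "s \<le> 1")
    case True
    then show ?thesis by simp
  next
    case False
    then obtain t where s: "s = Suc t" and t: "1 \<le> t" by (cases s) auto
    have p: "p > 0" using assms(1) prime_gt_0_nat by blast
    \<comment> \<open>\<open>q j\<close> is the factor by which the \<open>j\<close>-th terms of the relations for \<open>t\<close> and \<open>s\<close> differ;
      eliminating \<open>L 0 ^ (p ^ t - 1)\<close> leaves only the differences \<open>q 0 - q j\<close>.\<close>
    define q where "q j = L j ^ (p ^ (s - j) - p ^ (t - j))" for j
    have split: "L j ^ (p ^ (s - j) - 1) = L j ^ (p ^ (t - j) - 1) * q j" if "j \<le> t" for j
    proof -
      have "p ^ (t - j) \<le> p ^ (s - j)" using that s p by (intro power_increasing) auto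
      moreover have "1 \<le> p ^ (t - j)" using p by simp
      ultimately have "p ^ (s - j) - 1 = (p ^ (t - j) - 1) + (p ^ (s - j) - p ^ (t - j))"
        by linarith
      then show ?thesis unfolding q_def by (simp only: power_add)
    qed
    \<comment> \<open>With \<open>k = t - j - 1\<close>, both sides are powers with exponent
      \<open>p ^ k * (p - 1)\<close>, of \<open>L j ^ p\<close> and of \<open>L (Suc j)\<close>.
      These bases agree modulo \<open>p\<close>, hence their \<open>p ^ k\<close>-th powers agree
      modulo \<open>p ^ (k + 1)\<close>.\<close>
    have qstep: "of_nat (p ^ (t - j)) dvd q j - q (Suc j)" if "j < t" for j
    proof -
      define k where "k = t - Suc j"
      have k: "t - j = Suc k" using that by (simp add: k_def Suc_diff_Suc)
      have k': "s - j = Suc (Suc k)" "s - Suc j = Suc k" "t - Suc j = k" using s k that by auto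
      have e: "p ^ (s - j) - p ^ (t - j) = p * (p ^ k * (p - 1))"
        "p ^ (s - Suc j) - p ^ (t - Suc j) = p ^ k * (p - 1)"
        unfolding k k' by (simp_all add: algebra_simps)
      have "of_nat (p ^ Suc k) dvd (L j ^ p) ^ (p ^ k) - L (Suc j) ^ (p ^ k)"
        by (rule power_prime_power_cong[OF L])
      also have "\<dots> dvd ((L j ^ p) ^ (p ^ k)) ^ (p - 1) - (L (Suc j) ^ (p ^ k)) ^ (p - 1)"
        by (simp add: power_diff_sumr2)
      finally show ?thesis
        unfolding q_def e unfolding k power_mult .
    qed
    \<comment> \<open>Telescoping: the difference at \<open>i\<close> is divisible by
      \<open>p ^ (t - i)\<close>, and the weakest case \<open>i = j - 1\<close> gives exactly
      \<open>p ^ (s - j)\<close>.\<close>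
    have q0: "of_nat (p ^ (s - j)) dvd q 0 - q j" if "1 \<le> j" "j \<le> t" for j
    proof -
      have *: "q 0 - q j = (\<Sum>i<j. q i - q (Suc i))"
        by (simp add: sum_lessThan_telescope')
      have "of_nat (p ^ (s - j)) dvd q i - q (Suc i)" if "i < j" for i
      proof -
        have "s - j \<le> t - i" using that s by auto
        then have "p ^ (s - j) dvd p ^ (t - i)" by (rule le_imp_power_dvd)
        then show ?thesis
          by (rule dvd_trans[OF of_nat_dvd_of_nat qstep]) (use that \<open>j \<le> t\<close> in simp)
      qed
      then show ?thesis unfolding * by (intro dvd_sum) simp_all
    qed
    have "dwork_factor p L s = L 0 ^ (p ^ t - 1) * q 0 -
        (\<Sum>j\<in>{1..t}. dwork_factor p L j * (L j ^ (p ^ (t - j) - 1) * q j))"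
    proof -
      have "(\<Sum>j\<in>{1..<s}. dwork_factor p L j * L j ^ (p ^ (s - j) - 1)) =
          (\<Sum>j\<in>{1..t}. dwork_factor p L j * (L j ^ (p ^ (t - j) - 1) * q j))"
      proof (rule sum.cong)
        show "{1..<s} = {1..t}" using s by auto
        show "dwork_factor p L j * L j ^ (p ^ (s - j) - 1) =
            dwork_factor p L j * (L j ^ (p ^ (t - j) - 1) * q j)" if "j \<in> {1..t}" for j
          using that by (subst split) auto
      qed
      then show ?thesis
        using split[of 0] unfolding dwork_factor.simps[of p L s] by simp
    qed
    also have "L 0 ^ (p ^ t - 1) = (\<Sum>j\<in>{1..t}. dwork_factor p L j * L j ^ (p ^ (t - j) - 1))"
      by (rule dwork_factor_decomp[OF t])
    finally have *: "dwork_factor p L s =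
        (\<Sum>j\<in>{1..t}. dwork_factor p L j * L j ^ (p ^ (t - j) - 1) * (q 0 - q j))"
      by (simp add: sum_subtractf sum_distrib_right right_diff_distrib mult.assoc)
    show ?thesis unfolding *
    proof (rule dvd_sum)
      fix j assume j: "j \<in> {1..t}"
      have "of_nat (p ^ (j - 1)) * of_nat (p ^ (s - j)) dvd
          dwork_factor p L j * L j ^ (p ^ (t - j) - 1) * (q 0 - q j)"
        using j s less.IH[of j] q0[of j] by (intro mult_dvd_mono dvd_mult2) auto
      moreover have "p ^ (s - 1) = p ^ (j - 1) * p ^ (s - j)"
        using j s by (simp flip: power_add)
      ultimately show "of_nat (p ^ (s - 1)) dvd
          dwork_factor p L j * L j ^ (p ^ (t - j) - 1) * (q 0 - q j)"
        by simp
    qed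
  qed
qed

section \<open>The Frobenius lift on Laurent polynomials\<close>

lemma poly_mapping_sum_single:
  fixes F :: "'b \<Rightarrow>\<^sub>0 'a::comm_monoid_add"
  shows "(\<Sum>u\<in>Poly_Mapping.keys F. Poly_Mapping.single u (Poly_Mapping.lookup F u)) = F"
proof (rule poly_mapping_eqI)
  fix k
  have "Poly_Mapping.lookup (\<Sum>u\<in>Poly_Mapping.keys F. Poly_Mapping.single u (Poly_Mapping.lookup F u)) k =
      (\<Sum>u\<in>Poly_Mapping.keys F. if u = k then Poly_Mapping.lookup F u else 0)"
    by (simp add: lookup_sum lookup_single when_def)
  then show "Poly_Mapping.lookup (\<Sum>u\<in>Poly_Mapping.keys F. Poly_Mapping.single u (Poly_Mapping.lookup F u)) k = Poly_Mapping.lookup F k"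
    by (simp add: in_keys_iff)
qed

lemma lookup_mult_single:
  fixes F :: "'b::ab_group_add \<Rightarrow>\<^sub>0 'a::comm_semiring_0"
  shows "Poly_Mapping.lookup (F * Poly_Mapping.single b a) k = Poly_Mapping.lookup F (k - b) * a"
proof -
  have "F * Poly_Mapping.single b a = (\<Sum>u\<in>Poly_Mapping.keys F. Poly_Mapping.single (u + b) (Poly_Mapping.lookup F u * a))"
    by (subst (1) poly_mapping_sum_single[symmetric]) (simp add: sum_distrib_right mult_single)
  also have "Poly_Mapping.lookup \<dots> k = (\<Sum>u\<in>Poly_Mapping.keys F. if u = k - b then Poly_Mapping.lookup F u * a else 0)"
    unfolding lookup_sum lookup_single when_def by (intro sum.cong) (auto simp: algebra_simps)
  finally show ?thesis
    by (simp add: in_keys_iff)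
qed

lemma lookup_of_nat_mult:
  fixes F :: "'b::comm_monoid_add \<Rightarrow>\<^sub>0 'a::comm_semiring_1"
  shows "Poly_Mapping.lookup (of_nat m * F) k = of_nat m * Poly_Mapping.lookup F k"
  by (induction m) (simp_all add: algebra_simps lookup_add)

lemma of_nat_dvd_lookup:
  fixes F :: "'b::comm_monoid_add \<Rightarrow>\<^sub>0 'a::comm_semiring_1"
  assumes "of_nat m dvd F"
  shows "of_nat m dvd Poly_Mapping.lookup F k"
  using assms by (elim dvdE) (simp add: lookup_of_nat_mult)

lemma of_nat_dvd_single:
  fixes a :: "'a::comm_semiring_1"
  assumes "of_nat m dvd a"
  shows "of_nat m dvd Poly_Mapping.single (k :: 'b::comm_monoid_add) a"
proof -
  obtain c where "a = of_nat m * c" using assms by (elim dvdE)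
  \<comment> \<open>In the monoid algebra \<open>of_nat m\<close> is the constant
    \<open>single 0 (of_nat m)\<close>.\<close>
  then have "Poly_Mapping.single k a = of_nat m * Poly_Mapping.single k c"
    using mult_single[of 0 "of_nat m" k c] by simp
  then show ?thesis by simp
qed

lemma power_single:
  "Poly_Mapping.single u a ^ n = Poly_Mapping.single (int n *s u) (a ^ n)"
  for a :: "'a::comm_semiring_1" and u :: "int ^ 'n"
  by (induction n) (simp_all add: mult_single vector_sadd_rdistrib add.commute)

text \<open>With \<open>q = p ^ i\<close> and \<open>\<phi> = \<Phi> ^^ i\<close> this is sigma^i.
  Keeping both parameters free treats all iterates at once, and a sum of monomials makes sense even
  if scaling by \<open>q\<close> is not injective.\<close>

definition laurent_subst :: "nat \<Rightarrow> ('a::zero \<Rightarrow> 'b::comm_monoid_add) \<Rightarrow> ('a, 'n::finite) laurent_poly \<Rightarrow>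
    ('b, 'n) laurent_poly" where
  "laurent_subst q \<phi> F = (\<Sum>u\<in>Poly_Mapping.keys F. Poly_Mapping.single (int q *s u) (\<phi> (Poly_Mapping.lookup F u)))"

lemma keys_laurent_subst: "Poly_Mapping.keys (laurent_subst q \<phi> F) \<subseteq> (\<lambda>u. int q *s u) ` Poly_Mapping.keys F"
  unfolding laurent_subst_def by (rule order_trans[OF keys_sum]) (auto split: if_splits)

lemma laurent_subst_id: "laurent_subst 1 (\<lambda>x. x) F = F"
  by (simp add: laurent_subst_def poly_mapping_sum_single)

context comm_ring_hom
begin

text \<open>Additional terms vanish because \<open>hom 0 = 0\<close>. This gives \<open>F\<close>,
  \<open>G\<close> and \<open>F + G\<close> a common index set in the proof of additivity.\<close>

lemma laurent_subst_superset:
  assumes "finite A" and "Poly_Mapping.keys F \<subseteq> A"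
  shows "laurent_subst q hom F = (\<Sum>u\<in>A. Poly_Mapping.single (int q *s u) (hom (Poly_Mapping.lookup F u)))"
  unfolding laurent_subst_def using assms
  by (intro sum.mono_neutral_left) (auto simp: in_keys_iff)

lemma laurent_subst_zero: "laurent_subst q hom 0 = 0"
  by (simp add: laurent_subst_def)

lemma laurent_subst_one: "laurent_subst q hom 1 = 1"
  by (simp add: laurent_subst_def vector_smult_rzero)

lemma laurent_subst_single:
  "laurent_subst q hom (Poly_Mapping.single u a) = Poly_Mapping.single (int q *s u) (hom a)"
  by (simp add: laurent_subst_def)

lemma laurent_subst_add:
  "laurent_subst q hom (F + G) = laurent_subst q hom F + laurent_subst q hom G"
proof -
  have "laurent_subst q hom H =
      (\<Sum>u\<in>Poly_Mapping.keys F \<union> Poly_Mapping.keys G. Poly_Mapping.single (int q *s u) (hom (Poly_Mapping.lookup H u)))"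
    if "Poly_Mapping.keys H \<subseteq> Poly_Mapping.keys F \<union> Poly_Mapping.keys G" for H
    using that by (intro laurent_subst_superset) auto
  then show ?thesis
    by (simp add: keys_add lookup_add hom_add single_add sum.distrib)
qed

lemma laurent_subst_sum:
  "laurent_subst q hom (\<Sum>i\<in>I. F i) = (\<Sum>i\<in>I. laurent_subst q hom (F i))"
  by (induction I rule: infinite_finite_induct)
    (simp_all add: laurent_subst_zero laurent_subst_add)

text \<open>By additivity it is enough to expand both factors into monomials.\<close>

lemma laurent_subst_mult:
  "laurent_subst q hom (F * G) = laurent_subst q hom F * laurent_subst q hom G"
proof -
  have "F * G = (\<Sum>u\<in>Poly_Mapping.keys F. Poly_Mapping.single u (Poly_Mapping.lookup F u)) *
      (\<Sum>v\<in>Poly_Mapping.keys G. Poly_Mapping.single v (Poly_Mapping.lookup G v))"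
    by (simp only: poly_mapping_sum_single)
  then have "laurent_subst q hom (F * G) = (\<Sum>u\<in>Poly_Mapping.keys F. \<Sum>v\<in>Poly_Mapping.keys G.
      Poly_Mapping.single (int q *s u + int q *s v) (hom (Poly_Mapping.lookup F u) * hom (Poly_Mapping.lookup G v)))"
    by (simp add: sum_product mult_single laurent_subst_sum laurent_subst_single hom_mult
        vector_add_ldistrib)
  also have "\<dots> = laurent_subst q hom F * laurent_subst q hom G"
    by (simp add: laurent_subst_def sum_product mult_single)
  finally show ?thesis .
qed

lemma laurent_subst_power:
  "laurent_subst q hom (F ^ n) = laurent_subst q hom F ^ n"
  by (induction n) (simp_all add: laurent_subst_one laurent_subst_mult)

lemma lookup_mult_laurent_subst:
  "Poly_Mapping.lookup (F * laurent_subst q hom G) k =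
     (\<Sum>b\<in>Poly_Mapping.keys G. Poly_Mapping.lookup F (k - int q *s b) * hom (Poly_Mapping.lookup G b))"
  by (simp add: laurent_subst_def sum_distrib_left lookup_sum lookup_mult_single)

text \<open>Modulo \<open>p\<close>, the \<open>p\<close>-th power of a sum of monomials is the sum
  \<open>S\<close> of their \<open>p\<close>-th powers; there the exponents are multiplied by
  \<open>p\<close> and the coefficients \<open>c ^ p\<close> may be replaced by
  \<open>\<phi> c\<close>. For \<open>hom = \<Phi> ^^ i\<close> this compares sigma^i(\<Lambda>)^p
  with sigma^(i+1)(\<Lambda>).\<close>

lemma laurent_subst_frobenius_cong:
  fixes \<phi> :: "'b \<Rightarrow> 'b" and p q :: nat
  assumes "prime p" and \<phi>: "\<And>r. of_nat p dvd \<phi> r - r ^ p"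
  shows "of_nat p dvd laurent_subst q hom F ^ p - laurent_subst (q * p) (\<lambda>r. \<phi> (hom r)) F"
proof -
  define S where "S = (\<Sum>u\<in>Poly_Mapping.keys F. Poly_Mapping.single (int q *s u) (hom (Poly_Mapping.lookup F u)) ^ p)"
  have 1: "of_nat p dvd laurent_subst q hom F ^ p - S"
    unfolding S_def laurent_subst_def by (intro prime_power_sum_cong assms) simp
  have "S - laurent_subst (q * p) (\<lambda>r. \<phi> (hom r)) F = (\<Sum>u\<in>Poly_Mapping.keys F.
      Poly_Mapping.single (int (q * p) *s u) (hom (Poly_Mapping.lookup F u) ^ p - \<phi> (hom (Poly_Mapping.lookup F u))))"
    unfolding S_def laurent_subst_def
    by (simp add: power_single single_diff sum_subtractf vector_smult_assoc mult.commute)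
  also have "of_nat p dvd \<dots>"
  proof (intro dvd_sum of_nat_dvd_single)
    fix u
    have "of_nat p dvd - (\<phi> (hom (Poly_Mapping.lookup F u)) - hom (Poly_Mapping.lookup F u) ^ p)"
      unfolding dvd_minus_iff by (rule \<phi>)
    then show "of_nat p dvd hom (Poly_Mapping.lookup F u) ^ p - \<phi> (hom (Poly_Mapping.lookup F u))"
      by (simp only: minus_diff_eq)
  qed
  finally show ?thesis
    using dvd_add[OF 1, of "S - laurent_subst (q * p) (\<lambda>r. \<phi> (hom r)) F"] by simp
qed

end

section \<open>Supports inside dilates of a convex set\<close>

lemma real_point_add: "real_point (u + v) = real_point u + real_point v"
  and real_point_diff: "real_point (u - v) = real_point u - real_point v"
  and real_point_scale: "real_point (int q *s u) = real q *\<^sub>R real_point u"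
  by (simp_all add: real_point_def Finite_Cartesian_Product.vec_eq_iff)

text \<open>Exponents of a product are sums of exponents, and convexity puts
  \<open>a x + b y\<close> into the dilate by \<open>a + b\<close>.\<close>

lemma real_point_keys_mult:
  assumes "convex P" and "0 \<le> a" and "0 \<le> b"
    and F: "real_point ` Poly_Mapping.keys F \<subseteq> (*\<^sub>R) a ` P" and G: "real_point ` Poly_Mapping.keys G \<subseteq> (*\<^sub>R) b ` P"
  shows "real_point ` Poly_Mapping.keys (F * G) \<subseteq> (*\<^sub>R) (a + b) ` P"
proof (rule image_subsetI)
  fix w assume "w \<in> Poly_Mapping.keys (F * G)"
  then obtain u v where w: "w = u + v" "u \<in> Poly_Mapping.keys F" "v \<in> Poly_Mapping.keys G"
    using keys_mult by blast
  obtain x y where "x \<in> P" "y \<in> P" and uv: "real_point u = a *\<^sub>R x" "real_point v = b *\<^sub>R y"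
    using F G w by blast
  show "real_point w \<in> (*\<^sub>R) (a + b) ` P"
  \<comment> \<open>The convex combination \<open>z\<close> below divides by \<open>a + b\<close>,
    so the zero dilate is treated apart.\<close>
  proof (cases "a + b = 0")
    case True
    then have "a = 0" "b = 0" using assms(2,3) by auto
    then have "real_point w = (a + b) *\<^sub>R x" using uv w by (simp add: real_point_add)
    then show ?thesis using \<open>x \<in> P\<close> by blast
  next
    case False
    define z where "z = (a / (a + b)) *\<^sub>R x + (b / (a + b)) *\<^sub>R y"
    have "z \<in> P" unfolding z_def
      using assms(1-3) \<open>x \<in> P\<close> \<open>y \<in> P\<close> False
      by (intro convexD) (auto simp: add_divide_distrib[symmetric])
    moreover have "real_point w = (a + b) *\<^sub>R z"
      using False uv w by (simp add: z_def real_point_add scaleR_add_right)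
    ultimately show ?thesis by blast
  qed
qed

text \<open>For \<open>n = 0\<close> the bound could fail when \<open>P\<close> is empty, as the
  Newton polytope is for \<Lambda> = 0; the induction therefore starts at 1.\<close>

lemma real_point_keys_power:
  assumes "convex P" and "0 \<le> a" and "real_point ` Poly_Mapping.keys F \<subseteq> (*\<^sub>R) a ` P" and "1 \<le> n"
  shows "real_point ` Poly_Mapping.keys (F ^ n) \<subseteq> (*\<^sub>R) (real n * a) ` P"
  using assms(4)
proof (induction n rule: nat_induct_at_least)
  case base
  then show ?case using assms(3) by simp
next
  case (Suc n)
  have "real_point ` Poly_Mapping.keys (F * F ^ n) \<subseteq> (*\<^sub>R) (a + real n * a) ` P"
    using assms Suc.IH by (intro real_point_keys_mult) auto
  then show ?case by (simp add: algebra_simps)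
qed

lemma real_point_keys_laurent_subst:
  assumes "real_point ` Poly_Mapping.keys F \<subseteq> (*\<^sub>R) a ` P"
  shows "real_point ` Poly_Mapping.keys (laurent_subst q \<phi> F) \<subseteq> (*\<^sub>R) (real q * a) ` P"
proof -
  have "real_point ` Poly_Mapping.keys (laurent_subst q \<phi> F) \<subseteq>
      real_point ` (\<lambda>u. int q *s u) ` Poly_Mapping.keys F"
    by (rule image_mono[OF keys_laurent_subst])
  also have "\<dots> = (*\<^sub>R) (real q) ` real_point ` Poly_Mapping.keys F"
    by (simp add: image_image real_point_scale)
  also have "\<dots> \<subseteq> (*\<^sub>R) (real q) ` (*\<^sub>R) a ` P"
    using assms by (rule image_mono)
  finally show ?thesis by (simp add: image_image)
qed

text \<open>The dilation factors add up: (p^j - 1) + (p^(s-j) - 1) p^j = p^s - 1, so every term of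
  the recursion obeys the same bound.\<close>

lemma real_point_keys_dwork_factor:
  assumes p: "1 < p" and "convex P" and "1 \<le> s"
    and L: "\<And>i. real_point ` Poly_Mapping.keys (L i) \<subseteq> (*\<^sub>R) (real (p ^ i)) ` P"
  shows "real_point ` Poly_Mapping.keys (dwork_factor p L s) \<subseteq> (*\<^sub>R) (real (p ^ s - 1)) ` P"
  using \<open>1 \<le> s\<close>
proof (induction s rule: less_induct)
  case (less s)
  have 1: "1 \<le> p ^ k - 1" if "1 \<le> k" for k :: nat
    using one_less_power[OF p, of k] that by linarith
  have first: "real_point ` Poly_Mapping.keys (L 0 ^ (p ^ s - 1)) \<subseteq> (*\<^sub>R) (real (p ^ s - 1) * real (p ^ 0)) ` P"
    by (rule real_point_keys_power[OF assms(2) _ L 1[OF less.prems]]) simp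
  have rest: "real_point ` Poly_Mapping.keys (dwork_factor p L j * L j ^ (p ^ (s - j) - 1)) \<subseteq>
      (*\<^sub>R) (real (p ^ s - 1)) ` P" if "j \<in> {1..<s}" for j
  proof -
    have "real_point ` Poly_Mapping.keys (L j ^ (p ^ (s - j) - 1)) \<subseteq>
        (*\<^sub>R) (real (p ^ (s - j) - 1) * real (p ^ j)) ` P"
      using that by (intro real_point_keys_power[OF assms(2) _ L] 1) auto
    then have "real_point ` Poly_Mapping.keys (dwork_factor p L j * L j ^ (p ^ (s - j) - 1)) \<subseteq>
        (*\<^sub>R) (real (p ^ j - 1) + real (p ^ (s - j) - 1) * real (p ^ j)) ` P"
      using that by (intro real_point_keys_mult[OF assms(2)] less.IH) auto
    moreover have "real (p ^ j - 1) + real (p ^ (s - j) - 1) * real (p ^ j) = real (p ^ s - 1)"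
    proof -
      have pred: "real (p ^ k - 1) = real p ^ k - 1" for k using p by (simp add: of_nat_diff)
      have "a - 1 + (b - 1) * a = b * a - 1" for a b :: real by (simp add: algebra_simps)
      then have "real (p ^ j - 1) + real (p ^ (s - j) - 1) * real (p ^ j) =
          real p ^ (s - j) * real p ^ j - 1"
        unfolding pred of_nat_power .
      also have "real p ^ (s - j) * real p ^ j = real p ^ s"
        using that by (simp flip: power_add)
      finally show ?thesis unfolding pred .
    qed
    ultimately show ?thesis by simp
  qed
  have "Poly_Mapping.keys (dwork_factor p L s) \<subseteq> Poly_Mapping.keys (L 0 ^ (p ^ s - 1)) \<union>
      (\<Union>j\<in>{1..<s}. Poly_Mapping.keys (dwork_factor p L j * L j ^ (p ^ (s - j) - 1)))"
    unfolding dwork_factor.simps[of p L s]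
    by (rule order_trans[OF keys_diff Un_mono[OF order_refl keys_sum]])
  note image_mono[OF this, of real_point]
  also have "real_point ` (Poly_Mapping.keys (L 0 ^ (p ^ s - 1)) \<union> (\<Union>j\<in>{1..<s}.
      Poly_Mapping.keys (dwork_factor p L j * L j ^ (p ^ (s - j) - 1)))) \<subseteq> (*\<^sub>R) (real (p ^ s - 1)) ` P"
    using first rest by (simp add: image_Un image_UN UN_subset_iff)
  finally show ?case .
qed

section \<open>Congruences of matrices\<close>

text \<open>The size \<open>n\<close> is a parameter because an empty family of matrices does not
  determine it.\<close>

definition mat_sum :: "nat \<Rightarrow> ('i \<Rightarrow> 'a::comm_monoid_add mat) \<Rightarrow> 'i set \<Rightarrow> 'a mat" where
  "mat_sum n f I = Matrix.mat n n (\<lambda>ij. \<Sum>l\<in>I. f l $$ ij)"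

lemma mat_sum_mult_right:
  fixes f :: "'i \<Rightarrow> 'a::semiring_0 mat"
  assumes "\<And>l. l \<in> I \<Longrightarrow> f l \<in> carrier_mat n n" and "B \<in> carrier_mat n n"
  shows "mat_sum n f I * B = mat_sum n (\<lambda>l. f l * B) I"
proof (rule eq_matI)
  fix i j
  assume "i < dim_row (mat_sum n (\<lambda>l. f l * B) I)" "j < dim_col (mat_sum n (\<lambda>l. f l * B) I)"
  then have ij: "i < n" "j < n" by (simp_all add: mat_sum_def)
  have "(mat_sum n f I * B) $$ (i, j) = (\<Sum>k\<in>{0..<n}. \<Sum>l\<in>I. f l $$ (i, k) * B $$ (k, j))"
    using assms(2) ij by (simp add: mat_sum_def scalar_prod_def sum_distrib_right)
  also have "\<dots> = (\<Sum>l\<in>I. \<Sum>k\<in>{0..<n}. f l $$ (i, k) * B $$ (k, j))"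
    by (rule sum.swap)
  also have "\<dots> = (\<Sum>l\<in>I. (f l * B) $$ (i, j))"
  proof (rule sum.cong[OF refl])
    fix l assume "l \<in> I"
    from assms(1)[OF this] assms(2) ij
    show "(\<Sum>k\<in>{0..<n}. f l $$ (i, k) * B $$ (k, j)) = (f l * B) $$ (i, j)"
      by (auto simp: scalar_prod_def)
  qed
  finally show "(mat_sum n f I * B) $$ (i, j) = mat_sum n (\<lambda>l. f l * B) I $$ (i, j)"
    using ij by (simp add: mat_sum_def)
qed (use assms(2) in \<open>auto simp: mat_sum_def\<close>)

lemma mat_cong_iff:
  assumes "A \<in> carrier_mat n n" and "B \<in> carrier_mat n n"
  shows "mat_cong m A B \<longleftrightarrow> (\<forall>i<n. \<forall>j<n. of_nat m dvd A $$ (i, j) - B $$ (i, j))"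
  using assms by (auto simp: mat_cong_def)

lemma mat_cong_refl [simp]: "mat_cong m A A"
  by (simp add: mat_cong_def)

lemma mat_cong_sym:
  assumes "mat_cong m A B"
  shows "mat_cong m B A"
  unfolding mat_cong_def
proof (intro conjI allI impI)
  fix i j assume "i < dim_row B" "j < dim_col B"
  with assms have "of_nat m dvd A $$ (i, j) - B $$ (i, j)" by (simp add: mat_cong_def)
  then have "of_nat m dvd - (A $$ (i, j) - B $$ (i, j))" unfolding dvd_minus_iff .
  then show "of_nat m dvd B $$ (i, j) - A $$ (i, j)" by (simp only: minus_diff_eq)
qed (use assms in \<open>simp_all add: mat_cong_def\<close>)

lemma mat_cong_trans [trans]:
  assumes "mat_cong m A B" and "mat_cong m B C"
  shows "mat_cong m A C"
  unfolding mat_cong_def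
proof (intro conjI allI impI)
  fix i j assume "i < dim_row A" "j < dim_col A"
  with assms have "of_nat m dvd (A $$ (i, j) - B $$ (i, j)) + (B $$ (i, j) - C $$ (i, j))"
    unfolding mat_cong_def by (intro dvd_add) simp_all
  then show "of_nat m dvd A $$ (i, j) - C $$ (i, j)" by simp
qed (use assms in \<open>simp_all add: mat_cong_def\<close>)

lemma mat_cong_dvd:
  assumes "mat_cong m A B" and "k dvd m"
  shows "mat_cong k A B"
  using assms of_nat_dvd_of_nat[of k m] dvd_trans unfolding mat_cong_def by blast

text \<open>The moduli multiply: in each summand of an entry, \<open>A\<close> contributes
  \<open>k\<close> and the difference of \<open>B\<close> and \<open>C\<close> contributes
  \<open>m\<close>.\<close>

lemma mat_cong_mult_left:
  assumes "A \<in> carrier_mat n n" "B \<in> carrier_mat n n" "C \<in> carrier_mat n n"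
    and A: "mat_cong k A (0\<^sub>m n n)" and BC: "mat_cong m B C"
  shows "mat_cong (k * m) (A * B) (A * C)"
proof -
  have "of_nat (k * m) dvd (A * B) $$ (i, j) - (A * C) $$ (i, j)" if "i < n" "j < n" for i j
  proof -
    have *: "(A * B) $$ (i, j) - (A * C) $$ (i, j) =
        (\<Sum>l\<in>{0..<n}. A $$ (i, l) * (B $$ (l, j) - C $$ (l, j)))"
      using assms(1-3) that by (simp add: scalar_prod_def sum_subtractf right_diff_distrib)
    have "of_nat k * of_nat m dvd A $$ (i, l) * (B $$ (l, j) - C $$ (l, j))"
      if "l \<in> {0..<n}" for l
      using assms \<open>i < n\<close> \<open>j < n\<close> that by (intro mult_dvd_mono) (auto simp: mat_cong_def)
    then show ?thesis unfolding * of_nat_mult by (rule dvd_sum)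
  qed
  then show ?thesis using assms(1-3) by (subst mat_cong_iff) (auto simp del: of_nat_mult)
qed

lemma mat_cong_mult_right:
  assumes "A \<in> carrier_mat n n" "B \<in> carrier_mat n n" "C \<in> carrier_mat n n"
    and "mat_cong m A B"
  shows "mat_cong m (A * C) (B * C)"
proof -
  have "of_nat m dvd (A * C) $$ (i, j) - (B * C) $$ (i, j)" if "i < n" "j < n" for i j
  proof -
    have "(A * C) $$ (i, j) - (B * C) $$ (i, j) =
        (\<Sum>l\<in>{0..<n}. (A $$ (i, l) - B $$ (i, l)) * C $$ (l, j))"
      using assms(1-3) that by (simp add: scalar_prod_def sum_subtractf left_diff_distrib)
    also have "of_nat m dvd \<dots>"
      using assms that by (intro dvd_sum dvd_mult2) (auto simp: mat_cong_def)
    finally show ?thesis .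
  qed
  then show ?thesis using assms(1-3) by (subst mat_cong_iff) auto
qed

lemma mat_cong_mult:
  assumes carrier: "A \<in> carrier_mat n n" "A' \<in> carrier_mat n n" "B \<in> carrier_mat n n" "B' \<in> carrier_mat n n"
    and "mat_cong m A A'" and "mat_cong m B B'"
  shows "mat_cong m (A * B) (A' * B')"
proof -
  have first: "mat_cong m (A * B) (A' * B)"
    by (rule mat_cong_mult_right) fact+
  \<comment> \<open>Modulo 1 every matrix is congruent to zero, so the previous product rule applies
    with \<open>k = 1\<close>.\<close>
  have "mat_cong (1 * m) (A' * B) (A' * B')"
    using carrier assms(6) by (intro mat_cong_mult_left) (auto simp: mat_cong_def)
  then have second: "mat_cong m (A' * B) (A' * B')" by simp
  show ?thesis by (rule mat_cong_trans[OF first second])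
qed

lemma (in comm_ring_hom) mat_cong_hom:
  assumes "mat_cong m A B"
  shows "mat_cong m (map_mat hom A) (map_mat hom B)"
  unfolding mat_cong_def
proof (intro conjI allI impI)
  fix i j assume "i < dim_row (map_mat hom A)" "j < dim_col (map_mat hom A)"
  then have ij: "i < dim_row A" "j < dim_col A" by simp_all
  then obtain c where "A $$ (i, j) - B $$ (i, j) = of_nat m * c"
    using assms unfolding mat_cong_def by (meson dvdE)
  then have "hom (A $$ (i, j)) - hom (B $$ (i, j)) = of_nat m * hom c"
    by (metis hom_minus hom_mult hom_of_nat)
  then show "of_nat m dvd map_mat hom A $$ (i, j) - map_mat hom B $$ (i, j)"
    using ij assms by (simp add: mat_cong_def)
qed (use assms in \<open>simp_all add: mat_cong_def\<close>)

text \<open>Write \<open>U' = U' * V * V'\<close> and \<open>V' = U' * U * V'\<close>; the two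
  products differ only in the middle factor.\<close>

lemma mat_cong_inverse:
  assumes carrier: "U \<in> carrier_mat n n" "U' \<in> carrier_mat n n" "V \<in> carrier_mat n n" "V' \<in> carrier_mat n n"
    and "U' * U = 1\<^sub>m n" and "V * V' = 1\<^sub>m n" and "mat_cong m U V"
  shows "mat_cong m U' V'"
proof -
  have UV: "U' * U * V' = V'" using assms by simp
  have "mat_cong m (U' * V * V') (U' * U * V')"
    using assms mat_cong_sym by (intro mat_cong_mult) auto
  also have "U' * V * V' = U'"
    using assms by (simp add: assoc_mult_mat[OF carrier(2,3,4)])
  finally show ?thesis unfolding UV .
qed

text \<open>Compares sums of different lengths: the surplus terms have to vanish modulo
  \<open>m\<close>.\<close>

lemma mat_sum_cong:
  assumes J: "finite J" "I \<subseteq> J" and f: "\<And>l. l \<in> J \<Longrightarrow> f l \<in> carrier_mat n n"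
    and g: "\<And>l. l \<in> I \<Longrightarrow> g l \<in> carrier_mat n n"
    and "\<And>l. l \<in> I \<Longrightarrow> mat_cong m (f l) (g l)"
    and "\<And>l. l \<in> J - I \<Longrightarrow> mat_cong m (f l) (0\<^sub>m n n)"
  shows "mat_cong m (mat_sum n f J) (mat_sum n g I)"
proof -
  have "of_nat m dvd (\<Sum>l\<in>J. f l $$ (i, j)) - (\<Sum>l\<in>I. g l $$ (i, j))" if "i < n" "j < n" for i j
  proof -
    have "(\<Sum>l\<in>J. f l $$ (i, j)) - (\<Sum>l\<in>I. g l $$ (i, j)) =
        (\<Sum>l\<in>J - I. f l $$ (i, j)) + (\<Sum>l\<in>I. f l $$ (i, j) - g l $$ (i, j))"
      by (simp add: sum_subtractf sum.subset_diff[OF J(2,1)])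
    also have "of_nat m dvd \<dots>"
    proof (intro dvd_add dvd_sum)
      show "of_nat m dvd f l $$ (i, j)" if "l \<in> J - I" for l
        using assms(6)[OF that] f[of l] that \<open>i < n\<close> \<open>j < n\<close> by (auto simp: mat_cong_def)
      show "of_nat m dvd f l $$ (i, j) - g l $$ (i, j)" if "l \<in> I" for l
        using assms(5)[OF that] g[of l] that \<open>i < n\<close> \<open>j < n\<close> by (auto simp: mat_cong_def)
    qed
    finally show ?thesis .
  qed
  then show ?thesis by (subst mat_cong_iff) (auto simp: mat_sum_def)
qed

section \<open>Inverse matrices\<close>

lemma inverse_mat_carrier:
  assumes A: "A \<in> carrier_mat n n" and "invertible_mat (A :: 'a::comm_ring_1 mat)"
  shows "inverse_mat A \<in> carrier_mat n n" "A * inverse_mat A = 1\<^sub>m n" "inverse_mat A * A = 1\<^sub>m n"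
proof -
  note inv = inverse_mat[OF assms(2)]
  show 1: "A * inverse_mat A = 1\<^sub>m n" using inv(1) A by (simp add: inverts_mat_def)
  \<comment> \<open>The size of this identity matrix is not known in advance; comparing column
    counts in both products determines it.\<close>
  have 2: "inverse_mat A * A = 1\<^sub>m (dim_row (inverse_mat A))" using inv(2) by (simp add: inverts_mat_def)
  show 3: "inverse_mat A \<in> carrier_mat n n"
    using arg_cong[OF 1, of dim_col] arg_cong[OF 2, of dim_col] A by auto
  show "inverse_mat A * A = 1\<^sub>m n" using 2 3 by simp
qed

lemma inverse_mat_eqI:
  fixes A :: "'a::comm_ring_1 mat"
  assumes "A \<in> carrier_mat n n" "B \<in> carrier_mat n n" "A * B = 1\<^sub>m n" "B * A = 1\<^sub>m n"
  shows "inverse_mat A = B"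
proof -
  have AB: "inverts_mat A B" "inverts_mat B A" using assms by (auto simp: inverts_mat_def)
  moreover have "invertible_mat A"
    using AB assms unfolding invertible_mat_def by auto
  ultimately show ?thesis by (intro inverse_mat_unique[OF inverse_mat])
qed

text \<open>The defining equation of \<open>^^\<close> splits off the outermost \<Phi>; the
  telescoping arguments need the innermost one.\<close>

lemma map_mat_funpow_Suc: "map_mat (\<Phi> ^^ Suc j) A = map_mat (\<Phi> ^^ j) (map_mat \<Phi> A)"
  by (simp add: funpow_swap1 flip: funpow_Suc_right) (auto simp: funpow_swap1)

section \<open>Coefficient matrices\<close>

text \<open>Here \<open>w = (1/q) u + (1 - 1/q) y\<close> with \<open>y\<close> in the polytope. A
  point of a convex set moved by a positive proportion towards a relative interior point is itself
  in the relative interior.\<close>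

lemma internal_point_descent:
  assumes q: "1 \<le> q" and u: "u \<in> internal_points \<Lambda>"
    and w: "real_point (int q *s w - u) \<in> (*\<^sub>R) (real (q - 1)) ` newton_polytope \<Lambda>"
  shows "w \<in> internal_points \<Lambda>"
proof -
  obtain y where y: "y \<in> newton_polytope \<Lambda>"
    and eq: "real q *\<^sub>R real_point w - real_point u = (real q - 1) *\<^sub>R y"
    using w q by (auto simp: real_point_diff real_point_scale of_nat_diff)
  have "y - (1 / real q) *\<^sub>R (y - real_point u) \<in> rel_interior (newton_polytope \<Lambda>)"
    using u y q by (intro rel_interior_convex_shrink)
      (auto simp: internal_points_def newton_polytope_def convex_convex_hull)
  also have "y - (1 / real q) *\<^sub>R (y - real_point u) = real_point w"
  proof -
    have "real_point w = (1 / real q) *\<^sub>R (real q *\<^sub>R real_point w)" using q by simp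
    also have "real q *\<^sub>R real_point w = real_point u + (real q - 1) *\<^sub>R y"
      using eq by (simp add: algebra_simps)
    finally show ?thesis using q by (simp add: algebra_simps)
  qed
  finally show ?thesis by (simp add: internal_points_def)
qed

text \<open>Separating the scale \<open>q\<close> from the polynomial \<open>F\<close> lets one
  construction produce both alpha_s and gamma_j.\<close>

definition coeff_mat :: "nat \<Rightarrow> (int ^ 'n) list \<Rightarrow> ('a::zero, 'n::finite) laurent_poly \<Rightarrow> 'a mat" where
  "coeff_mat q us F = Matrix.mat (length us) (length us)
     (\<lambda>(i, j). Poly_Mapping.lookup F (int q *s (us ! j) - us ! i))"

lemma coeff_mat_carrier [simp]: "coeff_mat q us F \<in> carrier_mat (length us) (length us)"
  by (simp add: coeff_mat_def)

lemma hasse_witt_eq_coeff_mat: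
  "hasse_witt p \<Lambda> us s = coeff_mat (p ^ s) us (\<Lambda> ^ (p ^ s - 1))"
  by (simp add: hasse_witt_def coeff_mat_def)

lemma coeff_mat_one: "distinct us \<Longrightarrow> coeff_mat 1 us 1 = 1\<^sub>m (length us)"
  by (intro eq_matI) (auto simp: coeff_mat_def lookup_one when_def nth_eq_iff_index_eq)

text \<open>In the convolution put \<open>b = r v - w\<close>: the exponent in \<open>F\<close>
  becomes \<open>q w - u\<close> and the one in \<open>G\<close> becomes \<open>r v - w\<close>. The
  support bound on \<open>F\<close> forces \<open>w\<close> to be internal, so the sum over
  \<open>w\<close> is a matrix product indexed by the internal points.\<close>

lemma (in comm_ring_hom) coeff_mat_mult:
  assumes us: "distinct us" "set us = internal_points \<Lambda>" and q: "1 \<le> q"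
    and F: "real_point ` Poly_Mapping.keys F \<subseteq> (*\<^sub>R) (real (q - 1)) ` newton_polytope \<Lambda>"
  shows "coeff_mat (q * r) us (F * laurent_subst q hom G) =
    coeff_mat q us F * map_mat hom (coeff_mat r us G)"
proof (rule eq_matI)
  fix i j
  assume "i < dim_row (coeff_mat q us F * map_mat hom (coeff_mat r us G))"
    and "j < dim_col (coeff_mat q us F * map_mat hom (coeff_mat r us G))"
  then have ij: "i < length us" "j < length us" by (simp_all add: coeff_mat_def)
  define J where "J = internal_points \<Lambda>"
  have fin: "finite J" unfolding J_def by (rule finite_internal_points)
  define u v where "u = us ! i" and "v = us ! j"
  have u: "u \<in> J" using ij us unfolding u_def J_def by (metis nth_mem)
  define f where "f b = Poly_Mapping.lookup F (int (q * r) *s v - u - int q *s b) *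
    hom (Poly_Mapping.lookup G b)" for b
  define B where "B = (\<lambda>w. int r *s v - w) ` J"
  have arg: "int (q * r) *s v - u - int q *s b = int q *s (int r *s v - b) - u" for b
    by (simp add: vector_ssub_ldistrib vector_smult_assoc algebra_simps)
  have zero: "f b = 0" if "b \<notin> B" for b
  proof -
    have "int r *s v - b \<notin> J"
    proof
      assume "int r *s v - b \<in> J"
      then have "int r *s v - (int r *s v - b) \<in> B" unfolding B_def by (rule imageI)
      with that show False by simp
    qed
    then have "int q *s (int r *s v - b) - u \<notin> Poly_Mapping.keys F"
      using internal_point_descent[OF q, of u \<Lambda> "int r *s v - b"] u F
      unfolding J_def by blast
    then show ?thesis unfolding f_def arg by (simp add: in_keys_iff)
  qed
  have "coeff_mat (q * r) us (F * laurent_subst q hom G) $$ (i, j) =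
      (\<Sum>b\<in>Poly_Mapping.keys G. f b)"
    using ij by (simp add: coeff_mat_def lookup_mult_laurent_subst f_def u_def v_def)
  \<comment> \<open>Passing through the union trades one index set for the other: off the support of
    \<open>G\<close> its coefficient vanishes, off \<open>B\<close> that of \<open>F\<close>
    does.\<close>
  also have "\<dots> = (\<Sum>b\<in>Poly_Mapping.keys G \<union> B. f b)"
    using fin by (intro sum.mono_neutral_left) (auto simp: B_def f_def in_keys_iff)
  also have "\<dots> = (\<Sum>b\<in>B. f b)"
    using fin zero by (intro sum.mono_neutral_right) (auto simp: B_def)
  also have "\<dots> = (\<Sum>w\<in>J. f (int r *s v - w))"
    unfolding B_def by (subst sum.reindex) (auto intro!: inj_onI)
  also have "\<dots> = (\<Sum>k\<in>{0..<length us}. f (int r *s v - us ! k))"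
    by (rule sum.reindex_bij_betw[symmetric]) (use us in \<open>auto intro!: bij_betw_nth simp: J_def\<close>)
  also have "\<dots> = (coeff_mat q us F * map_mat hom (coeff_mat r us G)) $$ (i, j)"
    using ij unfolding f_def arg
    by (simp add: coeff_mat_def scalar_prod_def u_def v_def)
  finally show "coeff_mat (q * r) us (F * laurent_subst q hom G) $$ (i, j) =
    (coeff_mat q us F * map_mat hom (coeff_mat r us G)) $$ (i, j)" .
qed (simp_all add: coeff_mat_def)

section \<open>Iterates of \<Phi> and the decomposition of alpha_s\<close>

lemma comm_ring_hom_funpow:
  assumes "comm_ring_hom (\<Phi> :: 'a::comm_ring_1 \<Rightarrow> 'a)"
  shows "comm_ring_hom (\<Phi> ^^ k)"
proof -
  interpret comm_ring_hom \<Phi> by (rule assms)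
  show ?thesis
  proof (induction k)
    case 0
    show ?case by unfold_locales simp_all
  next
    case (Suc k)
    then interpret k: comm_ring_hom "\<Phi> ^^ k" .
    show ?case
      by unfold_locales (simp_all add: k.hom_add hom_add k.hom_mult hom_mult)
  qed
qed

text \<open>Taking coefficient matrices at scale \<open>p ^ s\<close> is additive, so it applies
  term by term to the relation defining the G_j. Both congruences are later derived from this
  statement, without returning to polynomials.\<close>

lemma hasse_witt_decomposition:
  fixes \<Phi> :: "'a::comm_ring_1 \<Rightarrow> 'a" and \<Lambda> :: "('a, 'n::finite) laurent_poly"
  assumes p: "prime p" and \<Phi>: "comm_ring_hom \<Phi>" and frob: "\<And>r. of_nat p dvd \<Phi> r - r ^ p"
    and us: "distinct us" "set us = internal_points \<Lambda>"
  shows "\<exists>\<gamma>. (\<forall>j. \<gamma> j \<in> carrier_mat (length us) (length us)) \<and>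
    (\<forall>j. mat_cong (p ^ (j - 1)) (\<gamma> j) (0\<^sub>m (length us) (length us))) \<and>
    (\<forall>s\<ge>1. hasse_witt p \<Lambda> us s = mat_sum (length us)
      (\<lambda>j. \<gamma> j * map_mat (\<Phi> ^^ j) (hasse_witt p \<Lambda> us (s - j))) {1..s})"
proof (intro exI conjI allI impI)
  define L where "L i = laurent_subst (p ^ i) (\<Phi> ^^ i) \<Lambda>" for i
  define \<gamma> where "\<gamma> j = coeff_mat (p ^ j) us (dwork_factor p L j)" for j
  have p1: "1 < p" using p prime_gt_1_nat by blast
  have hom: "comm_ring_hom (\<Phi> ^^ k)" for k by (rule comm_ring_hom_funpow[OF \<Phi>])
  have conv: "convex (newton_polytope \<Lambda>)"
    unfolding newton_polytope_def by (rule convex_convex_hull)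
  have L0: "L 0 = \<Lambda>" unfolding L_def using laurent_subst_id by (simp add: id_def)
  have Lstep: "of_nat p dvd L i ^ p - L (Suc i)" for i
    using comm_ring_hom.laurent_subst_frobenius_cong[OF hom p frob, of "p ^ i" i \<Lambda>]
    by (simp add: L_def mult.commute o_def)
  have "real_point ` Poly_Mapping.keys \<Lambda> \<subseteq> (*\<^sub>R) 1 ` newton_polytope \<Lambda>"
    unfolding newton_polytope_def using hull_subset[of _ convex] by simp
  then have supp: "real_point ` Poly_Mapping.keys (L i) \<subseteq> (*\<^sub>R) (real (p ^ i)) ` newton_polytope \<Lambda>" for i
    unfolding L_def using real_point_keys_laurent_subst[of \<Lambda> 1 _ "p ^ i"] by simp
  show "\<gamma> j \<in> carrier_mat (length us) (length us)" for j by (simp add: \<gamma>_def)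
  \<comment> \<open>For \<open>j = 0\<close> the truncated exponent makes the modulus 1.\<close>
  show "mat_cong (p ^ (j - 1)) (\<gamma> j) (0\<^sub>m (length us) (length us))" for j
    using of_nat_dvd_lookup[OF dwork_factor_dvd[where L = L, OF p Lstep]]
    by (auto simp: mat_cong_def \<gamma>_def coeff_mat_def simp del: of_nat_power)
  fix s :: nat assume s: "1 \<le> s"
  show "hasse_witt p \<Lambda> us s = mat_sum (length us)
      (\<lambda>j. \<gamma> j * map_mat (\<Phi> ^^ j) (hasse_witt p \<Lambda> us (s - j))) {1..s}"
  proof (rule eq_matI)
    fix i j assume "i < dim_row (mat_sum (length us)
      (\<lambda>j. \<gamma> j * map_mat (\<Phi> ^^ j) (hasse_witt p \<Lambda> us (s - j))) {1..s})"
      "j < dim_col (mat_sum (length us)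
      (\<lambda>j. \<gamma> j * map_mat (\<Phi> ^^ j) (hasse_witt p \<Lambda> us (s - j))) {1..s})"
    then have ij: "i < length us" "j < length us" by (simp_all add: mat_sum_def)
    have "hasse_witt p \<Lambda> us s $$ (i, j) = (\<Sum>l\<in>{1..s}. coeff_mat (p ^ s) us
        (dwork_factor p L l * L l ^ (p ^ (s - l) - 1)) $$ (i, j))"
      using ij dwork_factor_decomp[OF s, of L p]
      by (simp add: hasse_witt_eq_coeff_mat coeff_mat_def lookup_sum L0)
    also have "\<dots> = (\<Sum>l\<in>{1..s}. (\<gamma> l * map_mat (\<Phi> ^^ l) (hasse_witt p \<Lambda> us (s - l))) $$ (i, j))"
    proof (rule sum.cong[OF refl])
      fix l assume l: "l \<in> {1..s}"
      \<comment> \<open>Since sigma^l is multiplicative, \<open>L l ^ n\<close> is sigma^l of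
        \<open>\<Lambda> ^ n\<close>, the shape required for splitting off a matrix factor.\<close>
      have "coeff_mat (p ^ l * p ^ (s - l)) us
          (dwork_factor p L l * laurent_subst (p ^ l) (\<Phi> ^^ l) (\<Lambda> ^ (p ^ (s - l) - 1))) =
        \<gamma> l * map_mat (\<Phi> ^^ l) (hasse_witt p \<Lambda> us (s - l))"
        unfolding \<gamma>_def hasse_witt_eq_coeff_mat
        using real_point_keys_dwork_factor[OF p1 conv _ supp, of l] l p1
        by (intro comm_ring_hom.coeff_mat_mult[OF hom us]) auto
      moreover have "p ^ l * p ^ (s - l) = p ^ s" using l by (simp flip: power_add)
      ultimately show "coeff_mat (p ^ s) us (dwork_factor p L l * L l ^ (p ^ (s - l) - 1)) $$ (i, j) =
          (\<gamma> l * map_mat (\<Phi> ^^ l) (hasse_witt p \<Lambda> us (s - l))) $$ (i, j)"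
        by (simp add: L_def comm_ring_hom.laurent_subst_power[OF hom])
    qed
    finally show "hasse_witt p \<Lambda> us s $$ (i, j) = mat_sum (length us)
      (\<lambda>j. \<gamma> j * map_mat (\<Phi> ^^ j) (hasse_witt p \<Lambda> us (s - j))) {1..s} $$ (i, j)"
      using ij by (simp add: mat_sum_def)
  qed (simp_all add: mat_sum_def hasse_witt_def)
qed

section \<open>Consequences of the decomposition\<close>

text \<open>Both sides expand as sums of \<open>\<gamma> j * X j k\<close>, for \<open>k = s\<close>
  and \<open>k = s - 1\<close>. Corresponding \<open>X\<close> agree modulo
  \<open>p ^ (s + 1 - j)\<close>, and the factor \<open>p ^ (j - 1)\<close> of
  \<open>\<gamma> j\<close> raises this to \<open>p ^ s\<close>.\<close>

lemma dwork_congruence_from_decomposition: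
  fixes \<Phi> :: "'a::comm_ring_1 \<Rightarrow> 'a" and A \<gamma> :: "nat \<Rightarrow> 'a mat" and p :: nat
  assumes \<Phi>: "comm_ring_hom \<Phi>"
    and A: "\<And>s. A s \<in> carrier_mat n n" and \<gamma>: "\<And>j. \<gamma> j \<in> carrier_mat n n"
    and \<gamma>_cong: "\<And>j. mat_cong (p ^ (j - 1)) (\<gamma> j) (0\<^sub>m n n)"
    and decomp: "\<And>s. 1 \<le> s \<Longrightarrow> A s = mat_sum n (\<lambda>j. \<gamma> j * map_mat (\<Phi> ^^ j) (A (s - j))) {1..s}"
    and inv: "\<And>s. invertible_mat (A s)"
    and s: "1 \<le> s"
  shows "mat_cong (p ^ s) (A (s + 1) * inverse_mat (map_mat \<Phi> (A s)))
    (A s * inverse_mat (map_mat \<Phi> (A (s - 1))))"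
proof -
  interpret comm_ring_hom \<Phi> by (rule \<Phi>)
  define T where "T s = inverse_mat (A s)" for s
  note T = inverse_mat_carrier[OF A inv, folded T_def]
  have hom: "comm_ring_hom (\<Phi> ^^ k)" for k by (rule comm_ring_hom_funpow[OF \<Phi>])
  have map_mult: "map_mat (\<Phi> ^^ k) (B * C) = map_mat (\<Phi> ^^ k) B * map_mat (\<Phi> ^^ k) C"
    if "B \<in> carrier_mat n n" "C \<in> carrier_mat n n" for k B C
  proof -
    interpret k: comm_ring_hom "\<Phi> ^^ k" by (rule hom)
    show ?thesis using that by (rule k.mat_hom_mult)
  qed
  have map_one: "map_mat (\<Phi> ^^ k) (1\<^sub>m n) = 1\<^sub>m n" for k
  proof -
    interpret k: comm_ring_hom "\<Phi> ^^ k" by (rule hom)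
    show ?thesis by (rule k.mat_hom_one)
  qed
  have \<Phi>AT: "map_mat \<Phi> (A k) * map_mat \<Phi> (T k) = 1\<^sub>m n"
    and \<Phi>TA: "map_mat \<Phi> (T k) * map_mat \<Phi> (A k) = 1\<^sub>m n" for k
    unfolding mat_hom_mult[OF A T(1), symmetric] mat_hom_mult[OF T(1) A, symmetric] T(2,3)
    by (rule mat_hom_one)+
  have inv_\<Phi>: "inverse_mat (map_mat \<Phi> (A k)) = map_mat \<Phi> (T k)" for k
    using A T \<Phi>AT \<Phi>TA by (intro inverse_mat_eqI) auto
  \<comment> \<open>\<open>Y m\<close> is inverse to \<open>A (m + 1) * map_mat \<Phi> (T m)\<close>, so the claim for \<open>m < s\<close> controls it, and
    \<open>X j s\<close> is a telescoping product of images of the \<open>Y m\<close>.\<close>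
  define Y where "Y m = map_mat \<Phi> (A m) * T (m + 1)" for m
  define X where "X j s = map_mat (\<Phi> ^^ j) (A (s + 1 - j)) * map_mat \<Phi> (T s)" for j s
  have Y: "Y m \<in> carrier_mat n n" for m
    unfolding Y_def by (rule mult_carrier_mat[of _ n n]) (use A T in \<open>auto\<close>)
  have X: "X j s \<in> carrier_mat n n" for j s
    unfolding X_def by (rule mult_carrier_mat[of _ n n]) (use A T in \<open>auto\<close>)
  have X_1: "X 1 k = 1\<^sub>m n" for k unfolding X_def using \<Phi>AT by simp
  \<comment> \<open>Under \<open>\<Phi> ^^ j\<close>, the right factor \<open>T (k + 1 - j)\<close>
    of \<open>Y (k - j)\<close> cancels the left factor \<open>A (k + 1 - j)\<close> of
    \<open>X j k\<close>.\<close>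
  have X_Suc: "X (Suc j) k = map_mat (\<Phi> ^^ j) (Y (k - j)) * X j k" if "j \<le> k" for j k
  proof -
    have idx: "k - j + 1 = k + 1 - j" "k + 1 - Suc j = k - j" using that by auto
    let ?B = "map_mat (\<Phi> ^^ j) (map_mat \<Phi> (A (k - j)))" and ?C = "map_mat (\<Phi> ^^ j) (T (k + 1 - j))"
    let ?D = "map_mat (\<Phi> ^^ j) (A (k + 1 - j))" and ?E = "map_mat \<Phi> (T k)"
    have c: "?B \<in> carrier_mat n n" "?C \<in> carrier_mat n n" "?D \<in> carrier_mat n n" "?E \<in> carrier_mat n n"
      using A T by auto
    have CD: "?C * ?D = 1\<^sub>m n" unfolding map_mult[OF T(1) A, symmetric] T(3) by (rule map_one)
    have "map_mat (\<Phi> ^^ j) (Y (k - j)) = ?B * ?C"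
      unfolding Y_def idx using A T by (intro map_mult) simp_all
    then have "map_mat (\<Phi> ^^ j) (Y (k - j)) * X j k = ?B * ?C * (?D * ?E)"
      by (simp only: X_def)
    also have "\<dots> = ?B * ?C * ?D * ?E"
      using c by (intro assoc_mult_mat[symmetric, of _ n n _ n _ n] mult_carrier_mat[of _ n n])
    also have "?B * ?C * ?D = ?B * (?C * ?D)"
      using c by (intro assoc_mult_mat[of _ n n _ n _ n])
    also have "\<dots> = ?B" unfolding CD using c by simp
    finally show ?thesis unfolding X_def idx map_mat_funpow_Suc by simp
  qed
  have decomp_X: "A (k + 1) * map_mat \<Phi> (T k) = mat_sum n (\<lambda>j. \<gamma> j * X j k) {1..k + 1}" for k
  proof -
    have "A (k + 1) * map_mat \<Phi> (T k) =
        mat_sum n (\<lambda>j. \<gamma> j * map_mat (\<Phi> ^^ j) (A (k + 1 - j)) * map_mat \<Phi> (T k)) {1..k + 1}"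
      using A T \<gamma>
      by (subst decomp[of "k + 1"]) (auto intro!: mat_sum_mult_right mult_carrier_mat[of _ n n])
    also have "(\<lambda>j. \<gamma> j * map_mat (\<Phi> ^^ j) (A (k + 1 - j)) * map_mat \<Phi> (T k)) = (\<lambda>j. \<gamma> j * X j k)"
      unfolding X_def using A T \<gamma> by (intro ext assoc_mult_mat[of _ n n _ n _ n]) auto
    finally show ?thesis .
  qed
  have "mat_cong (p ^ s) (A (s + 1) * map_mat \<Phi> (T s)) (A s * map_mat \<Phi> (T (s - 1)))"
    using s
  proof (induction s rule: less_induct)
    case (less s)
    \<comment> \<open>The induction hypothesis at \<open>m\<close> passes to inverses.\<close>
    have Y_cong: "mat_cong (p ^ m) (Y m) (Y (m - 1))" if m: "1 \<le> m" "m < s" for m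
    proof (rule mat_cong_inverse)
      have assoc: "B * C * (D * E) = B * (C * D) * E"
        if "B \<in> carrier_mat n n" "C \<in> carrier_mat n n" "D \<in> carrier_mat n n" "E \<in> carrier_mat n n"
        for B C D E :: "'a mat"
        using that by (simp add: assoc_mult_mat[of _ n n _ n _ n] mult_carrier_mat[of _ n n _ n])
      show "mat_cong (p ^ m) (A (m + 1) * map_mat \<Phi> (T m)) (A m * map_mat \<Phi> (T (m - 1)))"
        using less.IH m by blast
      have c: "map_mat \<Phi> (A k) \<in> carrier_mat n n" "map_mat \<Phi> (T k) \<in> carrier_mat n n" for k
        using A T by simp_all
      show "Y m * (A (m + 1) * map_mat \<Phi> (T m)) = 1\<^sub>m n"
        unfolding Y_def assoc[OF c(1) T(1) A c(2)] T(3) right_mult_one_mat[OF c(1)] by (rule \<Phi>AT)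
      have "Y (m - 1) = map_mat \<Phi> (A (m - 1)) * T m" using m by (simp add: Y_def)
      then show "A m * map_mat \<Phi> (T (m - 1)) * Y (m - 1) = 1\<^sub>m n"
        by (simp only: assoc[OF A c(2) c(1) T(1)] \<Phi>TA right_mult_one_mat[OF A] T(2))
    qed (use A T Y in \<open>auto intro!: mult_carrier_mat[of _ n n]\<close>)
    \<comment> \<open>Each increase of \<open>j\<close> costs one factor \<open>p\<close>, because
      the new factor \<open>Y (s - j)\<close> is controlled only modulo \<open>p ^ (s - j)\<close>.
      The start \<open>j = 1\<close> is an equality of identity matrices.\<close>
    have X_cong: "mat_cong (p ^ (s + 1 - j)) (X j s) (X j (s - 1))" if "1 \<le> j" "j \<le> s" for j
      using that
    proof (induction j rule: nat_induct_at_least)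
      case base
      show ?case unfolding X_1 by simp
    next
      case (Suc j)
      have "p ^ (s - j) dvd p ^ (s + 1 - j)" by (rule le_imp_power_dvd) simp
      with Suc have 1: "mat_cong (p ^ (s - j)) (X j s) (X j (s - 1))"
        by (intro mat_cong_dvd[OF Suc.IH]) auto
      have "mat_cong (p ^ (s - j)) (Y (s - j)) (Y (s - j - 1))"
        using Suc by (intro Y_cong) auto
      then have "mat_cong (p ^ (s - j)) (map_mat (\<Phi> ^^ j) (Y (s - j))) (map_mat (\<Phi> ^^ j) (Y (s - 1 - j)))"
        by (simp add: comm_ring_hom.mat_cong_hom[OF hom] diff_commute)
      with 1 show ?case
        using Suc X Y by (simp add: X_Suc) (intro mat_cong_mult[of _ n], auto)
    qed
    have "mat_cong (p ^ s) (mat_sum n (\<lambda>j. \<gamma> j * X j s) {1..s + 1})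
        (mat_sum n (\<lambda>j. \<gamma> j * X j (s - 1)) {1..s})"
    proof (rule mat_sum_cong)
      fix j assume j: "j \<in> {1..s}"
      have "mat_cong (p ^ (j - 1) * p ^ (s + 1 - j)) (\<gamma> j * X j s) (\<gamma> j * X j (s - 1))"
        using j by (intro mat_cong_mult_left[OF \<gamma> X X \<gamma>_cong X_cong]) auto
      moreover have "p ^ (j - 1) * p ^ (s + 1 - j) = p ^ s"
        using j by (simp flip: power_add)
      ultimately show "mat_cong (p ^ s) (\<gamma> j * X j s) (\<gamma> j * X j (s - 1))" by simp
    next
      \<comment> \<open>The last term has no partner in the shorter sum, but
        \<open>\<gamma> (s + 1)\<close> is itself divisible by \<open>p ^ s\<close>.\<close>
      fix j assume "j \<in> {1..s + 1} - {1..s}"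
      then have "j = s + 1" by auto
      then have "mat_cong (p ^ s) (\<gamma> j * X j s) (0\<^sub>m n n * X j s)"
        using \<gamma>_cong[of j] by (intro mat_cong_mult_right[OF \<gamma> _ X]) auto
      then show "mat_cong (p ^ s) (\<gamma> j * X j s) (0\<^sub>m n n)"
        by (simp only: left_mult_zero_mat[OF X])
    qed (use X \<gamma> in \<open>auto intro!: mult_carrier_mat\<close>)
    then show ?case
      using less.prems decomp_X[of s] decomp_X[of "s - 1"] by simp
  qed
  then show ?thesis unfolding inv_\<Phi> .
qed

text \<open>Modulo \<open>p\<close> only the term \<open>j = 1\<close> survives, whence
  \<open>A (s + 1)\<close> is congruent to \<open>A 1 * \<Phi>(A s)\<close>; iterating this gives
  the product.\<close>

lemma hasse_witt_cong_from_decomposition: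
  fixes \<Phi> :: "'a::comm_ring_1 \<Rightarrow> 'a" and A \<gamma> :: "nat \<Rightarrow> 'a mat" and p :: nat
  assumes \<Phi>: "comm_ring_hom \<Phi>"
    and A: "\<And>s. A s \<in> carrier_mat n n" and A0: "A 0 = 1\<^sub>m n" and \<gamma>: "\<And>j. \<gamma> j \<in> carrier_mat n n"
    and \<gamma>_cong: "\<And>j. mat_cong (p ^ (j - 1)) (\<gamma> j) (0\<^sub>m n n)"
    and decomp: "\<And>s. 1 \<le> s \<Longrightarrow> A s = mat_sum n (\<lambda>j. \<gamma> j * map_mat (\<Phi> ^^ j) (A (s - j))) {1..s}"
  shows "mat_cong p (A s) (foldr (\<lambda>i M. map_mat (\<Phi> ^^ i) (A 1) * M) [0..<s] (1\<^sub>m n))"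
proof -
  interpret comm_ring_hom \<Phi> by (rule \<Phi>)
  have hom: "comm_ring_hom (\<Phi> ^^ k)" for k by (rule comm_ring_hom_funpow[OF \<Phi>])
  \<comment> \<open>The decomposition for \<open>s = 1\<close> has the single term
    \<open>\<gamma> 1\<close> times the image of \<open>A 0 = 1\<close>.\<close>
  have A1: "A 1 = \<gamma> 1"
  proof -
    have "A 1 = mat_sum n (\<lambda>j. \<gamma> j * map_mat (\<Phi> ^^ j) (A (1 - j))) {1}"
      using decomp[of 1] by simp
    also have "\<dots> = \<gamma> 1"
      using \<gamma>[of 1] by (intro eq_matI) (auto simp: mat_sum_def A0 mat_hom_one)
    finally show ?thesis .
  qed
  have step: "mat_cong p (A (Suc s)) (A 1 * map_mat \<Phi> (A s))" for s
  proof -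
    have "mat_cong p (mat_sum n (\<lambda>j. \<gamma> j * map_mat (\<Phi> ^^ j) (A (Suc s - j))) {1..Suc s})
        (mat_sum n (\<lambda>j. \<gamma> j * map_mat (\<Phi> ^^ j) (A (Suc s - j))) {1})"
    proof (rule mat_sum_cong)
      fix j assume j: "j \<in> {1..Suc s} - {1}"
      then have "mat_cong p (\<gamma> j) (0\<^sub>m n n)"
        by (intro mat_cong_dvd[OF \<gamma>_cong]) auto
      then have "mat_cong p (\<gamma> j * map_mat (\<Phi> ^^ j) (A (Suc s - j)))
          (0\<^sub>m n n * map_mat (\<Phi> ^^ j) (A (Suc s - j)))"
        using A \<gamma> by (intro mat_cong_mult_right[of _ n]) auto
      then show "mat_cong p (\<gamma> j * map_mat (\<Phi> ^^ j) (A (Suc s - j))) (0\<^sub>m n n)"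
        using A[of "Suc s - j"] by simp
    qed (use A \<gamma> in \<open>auto intro!: mult_carrier_mat\<close>)
    also have "mat_sum n (\<lambda>j. \<gamma> j * map_mat (\<Phi> ^^ j) (A (Suc s - j))) {1} = A 1 * map_mat \<Phi> (A s)"
      unfolding A1 using \<gamma>[of 1] A[of s] by (intro eq_matI) (auto simp: mat_sum_def)
    finally show ?thesis using decomp[of "Suc s"] by simp
  qed
  have carrier: "foldr (\<lambda>i M. map_mat (\<Phi> ^^ i) (A 1) * M) xs (1\<^sub>m n) \<in> carrier_mat n n" for xs
    by (induction xs) (use A in \<open>auto intro!: mult_carrier_mat\<close>)
  \<comment> \<open>The starting exponent \<open>i\<close> is generalized because each step moves
    one more \<Phi> onto the remaining product.\<close>
  have *: "mat_cong p (map_mat (\<Phi> ^^ i) (A s))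
      (foldr (\<lambda>i M. map_mat (\<Phi> ^^ i) (A 1) * M) [i..<i + s] (1\<^sub>m n))" for i
  proof (induction s arbitrary: i)
    case 0
    interpret i: comm_ring_hom "\<Phi> ^^ i" by (rule hom)
    show ?case by (simp add: A0 i.mat_hom_one)
  next
    case (Suc s)
    interpret i: comm_ring_hom "\<Phi> ^^ i" by (rule hom)
    have "mat_cong p (map_mat (\<Phi> ^^ i) (A (Suc s))) (map_mat (\<Phi> ^^ i) (A 1 * map_mat \<Phi> (A s)))"
      by (rule i.mat_cong_hom[OF step])
    also have "map_mat (\<Phi> ^^ i) (A 1 * map_mat \<Phi> (A s)) =
        map_mat (\<Phi> ^^ i) (A 1) * map_mat (\<Phi> ^^ Suc i) (A s)"
      unfolding map_mat_funpow_Suc using A by (intro i.mat_hom_mult[of _ n n _ n]) simp_all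
    also have "mat_cong p \<dots> (map_mat (\<Phi> ^^ i) (A 1) *
        foldr (\<lambda>i M. map_mat (\<Phi> ^^ i) (A 1) * M) [Suc i..<Suc i + s] (1\<^sub>m n))"
      using A carrier Suc.IH[of "Suc i"] by (intro mat_cong_mult[of _ n]) (auto simp del: funpow.simps)
    finally show ?case by (simp add: upt_conv_Cons del: upt_Suc)
  qed
  have "map_mat (\<Phi> ^^ 0) (A s) = A s" by (rule eq_matI) simp_all
  then show ?thesis using *[of 0] unfolding add_0 by (simp only:)
qed

theorem theorem1:
  fixes p :: nat
    and \<Phi> :: "'a::comm_ring_1 \<Rightarrow> 'a"
    and \<Lambda> :: "('a, 'n::finite) laurent_poly"
    and us :: "(int ^ 'n) list"
    and \<alpha> :: "nat \<Rightarrow> 'a mat"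
  assumes "prime p"
    and "comm_ring_hom \<Phi>"
    and "\<And>r. of_nat p dvd \<Phi> r - r ^ p"
    and "distinct us" and "set us = internal_points \<Lambda>"
  defines "\<alpha> \<equiv> hasse_witt p \<Lambda> us"
  shows "(\<forall>s\<ge>1. mat_cong p (\<alpha> s)
            (foldr (\<lambda>i M. map_mat (\<Phi> ^^ i) (\<alpha> 1) * M) [0..<s] (1\<^sub>m (length us)))) \<and>
         ((\<forall>s. invertible_mat (\<alpha> s)) \<longrightarrow>
            (\<forall>s\<ge>1. mat_cong (p ^ s)
               (\<alpha> (s + 1) * inverse_mat (map_mat \<Phi> (\<alpha> s)))
               (\<alpha> s * inverse_mat (map_mat \<Phi> (\<alpha> (s - 1))))))"
proof -
  have carrier: "\<alpha> s \<in> carrier_mat (length us) (length us)" for s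
    by (simp add: \<alpha>_def hasse_witt_def)
  \<comment> \<open>For \<open>s = 0\<close> the scale is 1 and the polynomial is
    \<open>\<Lambda> ^ 0 = 1\<close>.\<close>
  have \<alpha>0: "\<alpha> 0 = 1\<^sub>m (length us)"
    using coeff_mat_one[OF assms(4)] by (simp add: \<alpha>_def hasse_witt_eq_coeff_mat)
  obtain \<gamma> where "\<forall>j. \<gamma> j \<in> carrier_mat (length us) (length us)"
      "\<forall>j. mat_cong (p ^ (j - 1)) (\<gamma> j) (0\<^sub>m (length us) (length us))"
      "\<forall>s\<ge>1. \<alpha> s = mat_sum (length us)
        (\<lambda>j. \<gamma> j * map_mat (\<Phi> ^^ j) (\<alpha> (s - j))) {1..s}"
    using hasse_witt_decomposition[OF assms(1-5)] unfolding \<alpha>_def by (elim exE conjE)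
  note \<gamma> = this[rule_format]
  show ?thesis
  proof (intro conjI allI impI)
    show "mat_cong p (\<alpha> s)
        (foldr (\<lambda>i M. map_mat (\<Phi> ^^ i) (\<alpha> 1) * M) [0..<s] (1\<^sub>m (length us)))" for s
      by (rule hasse_witt_cong_from_decomposition[OF assms(2) carrier \<alpha>0 \<gamma>])
  next
    fix s :: nat
    assume "\<forall>s. invertible_mat (\<alpha> s)" and "1 \<le> s"
    then show "mat_cong (p ^ s) (\<alpha> (s + 1) * inverse_mat (map_mat \<Phi> (\<alpha> s)))
        (\<alpha> s * inverse_mat (map_mat \<Phi> (\<alpha> (s - 1))))"
      by (intro dwork_congruence_from_decomposition[OF assms(2) carrier \<gamma>]) simp_all
  qed
qed

end
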